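(* Let $R$ be a commutative Noetherian ring, $I$ an ideal of $R$ and $M$ a finitely generated $R$-module. Assume that $\widetilde{\mathcal R}(I,M)=\bigoplus_{n\geq 0}\widetilde{I^nM}$ is a Noetherian $\mathcal{R}(I)$-module and that $M$ is separated with respect to the $I$-adic topology. Then $H^0_I(M)=0$.
   Context: $\mathcal{R}(I)=\bigoplus_{n\geq 0}I^n$ is the Rees algebra of $I$. $H^0_I(M)=\{m\in M : I^nm=0 \text{ for some } n\geq 1\}$. For a submodule $A$ of $M$ and an ideal $L$ of $R$, $(A:_M L)=\{m\in M : Lm\subseteq A\}$. For $n\geq 1$, $\widetilde{I^nM}=\bigcup_{k\geq 1}(I^{n+k}M:_M I^k)$ (an ascending union of submodules of $M$), and $\widetilde{I^0M}=M$. One has $I^n\,\widetilde{I^mM}\subseteq\widetilde{I^{n+m}M}$, which gives the graded $\mathcal{R}(I)$-module structure on $\widetilde{\mathcal R}(I,M)$. $M$ is separated in the $I$-adic topology if $\bigcap_{n\geq 1}I^nM=0$. *)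

theory Defs
  imports "HOL-Algebra.Ideal_Product" "HOL-Algebra.Ring_Divisibility" "HOL-Algebra.Subrings"
    "HOL-Algebra.UnivPoly"
begin

section \<open>Finitely generated and Noetherian modules\<close>

definition submodule_span ::
    "('a, 'c) ring_scheme \<Rightarrow> ('a, 'b, 'd) module_scheme \<Rightarrow> 'b set \<Rightarrow> 'b set"
  where "submodule_span R M S = \<Inter>{N. submodule N R M \<and> S \<subseteq> N}"

locale finitely_generated_module = module R M
  for R :: "('a, 'c) ring_scheme" (structure) and M :: "('a, 'b, 'd) module_scheme" (structure) +
  assumes finitely_generated:
    "\<exists>A \<subseteq> carrier M. finite A \<and> carrier M = submodule_span R M A"

locale noetherian_module = module R M
  for R :: "('a, 'c) ring_scheme" (structure) and M :: "('a, 'b, 'd) module_scheme" (structure) +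
  assumes submodules_finitely_generated:
    "submodule N R M \<Longrightarrow> \<exists>A \<subseteq> carrier M. finite A \<and> N = submodule_span R M A"


section \<open>Ideal powers, colon submodules and the Ratliff-Rush filtration\<close>

text \<open>Powers are taken in the monoid of ideals, so the zeroth power is the whole ring.\<close>

abbreviation ideal_pow :: "('a, 'c) ring_scheme \<Rightarrow> 'a set \<Rightarrow> nat \<Rightarrow> 'a set"
  where "ideal_pow R I n \<equiv> I [^]\<^bsub>ideals_set R\<^esub> n"

definition ideal_smult ::
    "('a, 'c) ring_scheme \<Rightarrow> ('a, 'b, 'd) module_scheme \<Rightarrow> 'a set \<Rightarrow> 'b set \<Rightarrow> 'b set"
  where "ideal_smult R M J N = submodule_span R M {a \<odot>\<^bsub>M\<^esub> x | a x. a \<in> J \<and> x \<in> N}"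

definition module_colon :: "('a, 'b, 'd) module_scheme \<Rightarrow> 'b set \<Rightarrow> 'a set \<Rightarrow> 'b set"
  where "module_colon M A L = {m \<in> carrier M. \<forall>a \<in> L. a \<odot>\<^bsub>M\<^esub> m \<in> A}"

definition ratliff_rush ::
    "('a, 'c) ring_scheme \<Rightarrow> ('a, 'b, 'd) module_scheme \<Rightarrow> 'a set \<Rightarrow> nat \<Rightarrow> 'b set"
  where "ratliff_rush R M I n =
    (if n = 0 then carrier M
     else \<Union>k \<in> {1..}. module_colon M (ideal_smult R M (ideal_pow R I (n + k)) (carrier M))
                                      (ideal_pow R I k))"

definition adically_separated ::
    "('a, 'c) ring_scheme \<Rightarrow> ('a, 'b, 'd) module_scheme \<Rightarrow> 'a set \<Rightarrow> bool"
  where "adically_separated R M I \<longleftrightarrow>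
    (\<Inter>n \<in> {1..}. ideal_smult R M (ideal_pow R I n) (carrier M)) = {\<zero>\<^bsub>M\<^esub>}"

definition torsion_H0 ::
    "('a, 'c) ring_scheme \<Rightarrow> ('a, 'b, 'd) module_scheme \<Rightarrow> 'a set \<Rightarrow> 'b set"
  where "torsion_H0 R M I =
    {m \<in> carrier M. \<exists>n \<ge> 1. \<forall>a \<in> ideal_pow R I n. a \<odot>\<^bsub>M\<^esub> m = \<zero>\<^bsub>M\<^esub>}"


section \<open>The Rees algebra and the Ratliff-Rush module\<close>

text \<open>
  The direct sum of the powers of \<open>I\<close> consists of the finitely supported sequences whose
  \<open>n\<close>-th entry lies in the \<open>n\<close>-th power of \<open>I\<close>.  With the graded product it is a subring of
  the polynomial ring over \<open>R\<close>, whose elements in the library are finitely supported sequences.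
\<close>

definition rees_algebra :: "('a, 'c) ring_scheme \<Rightarrow> 'a set \<Rightarrow> ('a, nat \<Rightarrow> 'a) up_ring"
  where "rees_algebra R I =
    (UP R)\<lparr>carrier := {p \<in> carrier (UP R). \<forall>n. coeff (UP R) p n \<in> ideal_pow R I n}\<rparr>"

text \<open>
  Scalar multiplication is the graded one: degree \<open>i\<close> times degree \<open>j\<close> lands in degree \<open>i + j\<close>.
  The fields \<open>mult\<close> and \<open>one\<close> are forced by the record type and are not used by
  \<^locale>\<open>module\<close>.
\<close>

definition ratliff_rush_module ::
    "('a, 'c) ring_scheme \<Rightarrow> ('a, 'b, 'd) module_scheme \<Rightarrow> 'a set \<Rightarrow>
      (nat \<Rightarrow> 'a, nat \<Rightarrow> 'b) module"
  where "ratliff_rush_module R M I =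
    \<lparr>carrier = {f. (\<forall>n. f n \<in> ratliff_rush R M I n) \<and> finite {n. f n \<noteq> \<zero>\<^bsub>M\<^esub>}},
     monoid.mult = undefined,
     one = undefined,
     zero = (\<lambda>n. \<zero>\<^bsub>M\<^esub>),
     add = (\<lambda>f g n. f n \<oplus>\<^bsub>M\<^esub> g n),
     smult = (\<lambda>p f n. \<Oplus>\<^bsub>M\<^esub>i \<in> {..n}. coeff (UP R) p i \<odot>\<^bsub>M\<^esub> f (n - i))\<rparr>"


section \<open>The Ratliff-Rush module is a module over the Rees algebra\<close>

text \<open>
  Consequently the \<^locale>\<open>module\<close> part of \<^locale>\<open>noetherian_module\<close> is automatic here, and
  Noetherianity is only the finite generation of all submodules.
\<close>

context module
begin

lemma submodule_subset: "submodule N R M \<Longrightarrow> N \<subseteq> carrier M"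
  by (rule submoduleE(1))

lemma submodule_zero: "submodule N R M \<Longrightarrow> \<zero>\<^bsub>M\<^esub> \<in> N"
  using subgroup.one_closed[of N "add_monoid M"] by (simp add: submodule_def)

lemma submodule_span_superset: "S \<subseteq> submodule_span R M S"
  by (auto simp: submodule_span_def)

lemma submodule_span_least: "submodule N R M \<Longrightarrow> S \<subseteq> N \<Longrightarrow> submodule_span R M S \<subseteq> N"
  by (auto simp: submodule_span_def)

lemma submodule_span_submodule:
  assumes "S \<subseteq> carrier M"
  shows "submodule (submodule_span R M S) R M"
proof (rule submoduleI)
  show "submodule_span R M S \<subseteq> carrier M"
    using carrier_is_submodule assms by (rule submodule_span_least)
qed (auto simp: submodule_span_def submodule_zero submoduleE)

lemma module_colon_submodule:
  assumes A: "submodule A R M" and L: "L \<subseteq> carrier R"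
  shows "submodule (module_colon M A L) R M"
proof (rule submoduleI)
  fix a x assume ax: "a \<in> carrier R" "x \<in> module_colon M A L"
  have "b \<odot>\<^bsub>M\<^esub> (a \<odot>\<^bsub>M\<^esub> x) \<in> A" if b: "b \<in> L" for b
  proof -
    have "b \<odot>\<^bsub>M\<^esub> (a \<odot>\<^bsub>M\<^esub> x) = a \<odot>\<^bsub>M\<^esub> (b \<odot>\<^bsub>M\<^esub> x)"
      using ax b L smult_assoc1[of a b x] smult_assoc1[of b a x] R.m_comm[of a b]
      by (auto simp: module_colon_def)
    then show ?thesis using submoduleE(4)[OF A] ax b by (auto simp: module_colon_def)
  qed
  with ax show "a \<odot>\<^bsub>M\<^esub> x \<in> module_colon M A L" by (auto simp: module_colon_def)
next
  fix x assume "x \<in> module_colon M A L"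
  then show "\<ominus>\<^bsub>M\<^esub> x \<in> module_colon M A L"
    using L submoduleE(3)[OF A] by (auto simp: module_colon_def smult_r_minus subset_iff)
next
  fix x y assume "x \<in> module_colon M A L" "y \<in> module_colon M A L"
  then show "x \<oplus>\<^bsub>M\<^esub> y \<in> module_colon M A L"
    using L submoduleE(5)[OF A] by (auto simp: module_colon_def smult_r_distr subset_iff)
qed (use L in \<open>auto simp: module_colon_def submodule_zero[OF A] subset_iff\<close>)

lemma ideal_pow_ideal:
  assumes "ideal I R" shows "ideal (ideal_pow R I n) R"
proof -
  interpret S: comm_monoid "ideals_set R" by (rule ideals_set_is_comm_monoid)
  have "ideal_pow R I n \<in> carrier (ideals_set R)"
    by (rule S.nat_pow_closed) (use assms in \<open>simp add: ideals_set_def\<close>)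
  then show ?thesis by (simp add: ideals_set_def)
qed

lemma ideal_pow_0: "ideal_pow R I 0 = carrier R"
  by (simp add: ideals_set_def)

lemma ideal_pow_add:
  assumes "ideal I R"
  shows "ideal_pow R I (n + m) = ideal_pow R I n \<cdot>\<^bsub>R\<^esub> ideal_pow R I m"
proof -
  interpret S: comm_monoid "ideals_set R" by (rule ideals_set_is_comm_monoid)
  have "I \<in> carrier (ideals_set R)" using assms by (simp add: ideals_set_def)
  from S.nat_pow_mult[OF this, of n m] show ?thesis by (simp add: ideals_set_def)
qed

lemma ideal_pow_mult:
  assumes "ideal I R" "a \<in> ideal_pow R I n" "b \<in> ideal_pow R I m"
  shows "a \<otimes> b \<in> ideal_pow R I (n + m)"
  unfolding ideal_pow_add[OF assms(1)] using assms(2,3) by (rule ideal_prod.prod)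

lemma ideal_pow_carr:
  assumes "ideal I R" "a \<in> ideal_pow R I n" shows "a \<in> carrier R"
  using ideal.Icarr[OF ideal_pow_ideal[OF assms(1)] assms(2)] .

lemma ideal_pow_subset: "ideal I R \<Longrightarrow> ideal_pow R I n \<subseteq> carrier R"
  using ideal_pow_carr by blast

lemma ideal_smult_submodule:
  assumes "ideal I R"
  shows "submodule (ideal_smult R M (ideal_pow R I n) (carrier M)) R M"
  unfolding ideal_smult_def
  by (rule submodule_span_submodule) (use ideal_pow_carr[OF assms, of _ n] in blast)

lemma ideal_smult_mem:
  assumes "a \<in> J" "x \<in> N" shows "a \<odot>\<^bsub>M\<^esub> x \<in> ideal_smult R M J N"
  unfolding ideal_smult_def
  by (rule subsetD[OF submodule_span_superset]) (use assms in blast)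

lemma ideal_pow_smult:
  assumes I: "ideal I R" and a: "a \<in> ideal_pow R I n"
    and y: "y \<in> ideal_smult R M (ideal_pow R I m) (carrier M)"
  shows "a \<odot>\<^bsub>M\<^esub> y \<in> ideal_smult R M (ideal_pow R I (n + m)) (carrier M)"
proof -
  let ?C = "module_colon M (ideal_smult R M (ideal_pow R I (n + m)) (carrier M)) (ideal_pow R I n)"
  have "submodule ?C R M"
    by (rule module_colon_submodule[OF ideal_smult_submodule[OF I] ideal_pow_subset[OF I]])
  moreover have "{b \<odot>\<^bsub>M\<^esub> x | b x. b \<in> ideal_pow R I m \<and> x \<in> carrier M} \<subseteq> ?C"
  proof clarify
    fix b x assume b: "b \<in> ideal_pow R I m" and x: "x \<in> carrier M"
    have "c \<odot>\<^bsub>M\<^esub> (b \<odot>\<^bsub>M\<^esub> x) \<in> ideal_smult R M (ideal_pow R I (n + m)) (carrier M)"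
      if c: "c \<in> ideal_pow R I n" for c
      using ideal_smult_mem[OF ideal_pow_mult[OF I c b] x]
        smult_assoc1[OF ideal_pow_carr[OF I c] ideal_pow_carr[OF I b] x] by simp
    then show "b \<odot>\<^bsub>M\<^esub> x \<in> ?C"
      using ideal_pow_carr[OF I b] x by (simp add: module_colon_def)
  qed
  ultimately have "ideal_smult R M (ideal_pow R I m) (carrier M) \<subseteq> ?C"
    unfolding ideal_smult_def[of R M "ideal_pow R I m"] by (rule submodule_span_least)
  with a y show ?thesis by (auto simp: module_colon_def)
qed

definition rr_colon :: "'a set \<Rightarrow> nat \<Rightarrow> nat \<Rightarrow> 'c set"
  where "rr_colon I n k =
    module_colon M (ideal_smult R M (ideal_pow R I (n + k)) (carrier M)) (ideal_pow R I k)"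

lemma rr_colon_submodule: "ideal I R \<Longrightarrow> submodule (rr_colon I n k) R M"
  unfolding rr_colon_def
  by (rule module_colon_submodule[OF ideal_smult_submodule ideal_pow_subset])

lemma rr_colon_Suc:
  assumes I: "ideal I R" shows "rr_colon I n k \<subseteq> rr_colon I n (Suc k)"
proof
  fix x assume x: "x \<in> rr_colon I n k"
  then have xc: "x \<in> carrier M" by (simp add: rr_colon_def module_colon_def)
  let ?N = "ideal_smult R M (ideal_pow R I (n + Suc k)) (carrier M)"
  note N = ideal_smult_submodule[OF I, of "n + Suc k"]
  have "a \<in> carrier R \<and> a \<odot>\<^bsub>M\<^esub> x \<in> ?N" if "a \<in> ideal_pow R I 1 \<cdot>\<^bsub>R\<^esub> ideal_pow R I k" for a
    using that
  proof (induct rule: ideal_prod.induct)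
    case (prod c d)
    have "c \<odot>\<^bsub>M\<^esub> (d \<odot>\<^bsub>M\<^esub> x) \<in> ideal_smult R M (ideal_pow R I (1 + (n + k))) (carrier M)"
      by (rule ideal_pow_smult[OF I prod(1)])
        (use x prod(2) in \<open>auto simp: rr_colon_def module_colon_def\<close>)
    then show ?case
      using smult_assoc1[OF ideal_pow_carr[OF I prod(1)] ideal_pow_carr[OF I prod(2)] xc]
        ideal_pow_carr[OF I prod(1)] ideal_pow_carr[OF I prod(2)] by simp
  next
    case (sum c d)
    then show ?case using submoduleE(5)[OF N] smult_l_distr xc by simp
  qed
  then show "x \<in> rr_colon I n (Suc k)"
    using xc ideal_pow_add[OF I, of 1 k] by (simp add: rr_colon_def module_colon_def)
qed

lemma rr_colon_mono:
  assumes "ideal I R" "k \<le> l" shows "rr_colon I n k \<subseteq> rr_colon I n l"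
  by (rule lift_Suc_mono_le[of "rr_colon I n", OF rr_colon_Suc[OF assms(1)] assms(2)])

lemma ratliff_rush_alt:
  "ratliff_rush R M I n = (if n = 0 then carrier M else \<Union>k \<in> {1..}. rr_colon I n k)"
  by (simp add: ratliff_rush_def rr_colon_def)

lemma ratliff_rush_submodule:
  assumes I: "ideal I R" shows "submodule (ratliff_rush R M I n) R M"
proof (cases "n = 0")
  case True then show ?thesis by (simp add: ratliff_rush_alt carrier_is_submodule)
next
  case False
  note rc = rr_colon_submodule[OF I]
  have "submodule (\<Union>k \<in> {1..}. rr_colon I n k) R M"
  proof (rule submoduleI)
    show "(\<Union>k \<in> {1..}. rr_colon I n k) \<subseteq> carrier M"
      using submodule_subset[OF rc] by blast
    have "\<zero>\<^bsub>M\<^esub> \<in> rr_colon I n 1" by (rule submodule_zero[OF rc])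
    then show "\<zero>\<^bsub>M\<^esub> \<in> (\<Union>k \<in> {1..}. rr_colon I n k)" by blast
  next
    fix x assume "x \<in> (\<Union>k \<in> {1..}. rr_colon I n k)"
    then obtain k where "k \<in> {1..}" "x \<in> rr_colon I n k" by blast
    then show "\<ominus>\<^bsub>M\<^esub> x \<in> (\<Union>k \<in> {1..}. rr_colon I n k)"
      using submoduleE(3)[OF rc] by blast
  next
    fix a x assume "a \<in> carrier R" "x \<in> (\<Union>k \<in> {1..}. rr_colon I n k)"
    then obtain k where "a \<in> carrier R" "k \<in> {1..}" "x \<in> rr_colon I n k" by blast
    then show "a \<odot>\<^bsub>M\<^esub> x \<in> (\<Union>k \<in> {1..}. rr_colon I n k)"
      using submoduleE(4)[OF rc] by blast
  next
    fix x y assume "x \<in> (\<Union>k \<in> {1..}. rr_colon I n k)" "y \<in> (\<Union>k \<in> {1..}. rr_colon I n k)"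
    then obtain k l where kl: "k \<ge> 1" "x \<in> rr_colon I n k" "y \<in> rr_colon I n l" by auto
    have "x \<in> rr_colon I n (max k l)" "y \<in> rr_colon I n (max k l)"
      using kl rr_colon_mono[OF I, of k "max k l" n] rr_colon_mono[OF I, of l "max k l" n]
      by auto
    then have "x \<oplus>\<^bsub>M\<^esub> y \<in> rr_colon I n (max k l)" by (rule submoduleE(5)[OF rc])
    moreover have "max k l \<in> {1..}" using kl by simp
    ultimately show "x \<oplus>\<^bsub>M\<^esub> y \<in> (\<Union>k \<in> {1..}. rr_colon I n k)" by blast
  qed
  with False show ?thesis by (simp add: ratliff_rush_alt)
qed

lemma ratliff_rush_carr: "ideal I R \<Longrightarrow> x \<in> ratliff_rush R M I n \<Longrightarrow> x \<in> carrier M"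
  using submodule_subset[OF ratliff_rush_submodule] by blast

lemma ideal_pow_smult_ratliff_rush:
  assumes I: "ideal I R" and a: "a \<in> ideal_pow R I n" and x: "x \<in> ratliff_rush R M I m"
  shows "a \<odot>\<^bsub>M\<^esub> x \<in> ratliff_rush R M I (n + m)"
proof -
  have xc: "x \<in> carrier M" and ac: "a \<in> carrier R"
    using ratliff_rush_carr[OF I x] ideal_pow_carr[OF I a] by auto
  have "\<exists>k \<ge> 1. \<forall>b \<in> ideal_pow R I k.
      b \<odot>\<^bsub>M\<^esub> x \<in> ideal_smult R M (ideal_pow R I (m + k)) (carrier M)"
  proof (cases "m = 0")
    case True then show ?thesis using xc by (intro exI[of _ 1]) (auto intro: ideal_smult_mem)
  next
    case False then show ?thesis
      using x by (auto simp: ratliff_rush_alt rr_colon_def module_colon_def)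
  qed
  then obtain k where k: "k \<ge> 1"
    "\<And>b. b \<in> ideal_pow R I k \<Longrightarrow>
      b \<odot>\<^bsub>M\<^esub> x \<in> ideal_smult R M (ideal_pow R I (m + k)) (carrier M)" by blast
  have "b \<odot>\<^bsub>M\<^esub> (a \<odot>\<^bsub>M\<^esub> x) \<in> ideal_smult R M (ideal_pow R I (n + m + k)) (carrier M)"
    if b: "b \<in> ideal_pow R I k" for b
  proof -
    have bc: "b \<in> carrier R" using ideal_pow_carr[OF I b] .
    have "b \<odot>\<^bsub>M\<^esub> (a \<odot>\<^bsub>M\<^esub> x) = a \<odot>\<^bsub>M\<^esub> (b \<odot>\<^bsub>M\<^esub> x)"
      using smult_assoc1[OF ac bc xc] smult_assoc1[OF bc ac xc] R.m_comm[OF ac bc] by simp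
    with ideal_pow_smult[OF I a k(2)[OF b]] show ?thesis by (simp add: add.assoc)
  qed
  then have "a \<odot>\<^bsub>M\<^esub> x \<in> rr_colon I (n + m) k"
    using ac xc by (simp add: rr_colon_def module_colon_def)
  with k(1) ac xc show ?thesis by (auto simp: ratliff_rush_alt)
qed

lemma submodule_finsum:
  assumes "submodule N R M" "finite A" "\<And>i. i \<in> A \<Longrightarrow> f i \<in> N"
  shows "(\<Oplus>\<^bsub>M\<^esub>i \<in> A. f i) \<in> N"
  using assms(2,3)
proof (induct A rule: finite_induct)
  case empty then show ?case using submodule_zero[OF assms(1)] by simp
next
  case (insert i A)
  have "f \<in> A \<rightarrow> carrier M" "f i \<in> carrier M" 
    using insert submodule_subset[OF assms(1)] by auto
  then show ?case using insert submoduleE(5)[OF assms(1)] by simp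
qed

lemma ideal_finsum:
  assumes "ideal J R" "finite A" "\<And>i. i \<in> A \<Longrightarrow> f i \<in> J"
  shows "(\<Oplus>i \<in> A. f i) \<in> J"
  using assms(2,3)
proof (induct A rule: finite_induct)
  case empty then show ?case
    using additive_subgroup.zero_closed[OF ideal.axioms(1)[OF assms(1)]] by simp
next
  case (insert i A)
  have "f \<in> A \<rightarrow> carrier R" "f i \<in> carrier R"
    using insert ideal.Icarr[OF assms(1)] by auto
  then show ?case
    using insert additive_subgroup.a_closed[OF ideal.axioms(1)[OF assms(1)]] by simp
qed

lemma finsum_smult_rdistr:
  assumes "finite A" "f \<in> A \<rightarrow> carrier R" "x \<in> carrier M"
  shows "(\<Oplus>i \<in> A. f i) \<odot>\<^bsub>M\<^esub> x = (\<Oplus>\<^bsub>M\<^esub>i \<in> A. f i \<odot>\<^bsub>M\<^esub> x)"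
  using assms
proof (induct A rule: finite_induct)
  case (insert i A)
  then have "(\<lambda>i. f i \<odot>\<^bsub>M\<^esub> x) \<in> A \<rightarrow> carrier M" by auto
  with insert show ?case by (simp add: smult_l_distr Pi_def)
qed simp

lemma graded_smult_assoc:
  fixes n :: nat
  assumes p: "\<And>i. p i \<in> carrier R" and q: "\<And>i. q i \<in> carrier R" and f: "\<And>i. f i \<in> carrier M"
  shows "(\<Oplus>\<^bsub>M\<^esub>k \<in> {..n}. (\<Oplus>i \<in> {..k}. p i \<otimes> q (k - i)) \<odot>\<^bsub>M\<^esub> f (n - k)) =
    (\<Oplus>\<^bsub>M\<^esub>i \<in> {..n}. p i \<odot>\<^bsub>M\<^esub> (\<Oplus>\<^bsub>M\<^esub>j \<in> {..n - i}. q j \<odot>\<^bsub>M\<^esub> f (n - i - j)))"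
proof -
  have "k \<le> n \<Longrightarrow>
      (\<Oplus>\<^bsub>M\<^esub>j \<in> {..k}. (\<Oplus>i \<in> {..j}. p i \<otimes> q (j - i)) \<odot>\<^bsub>M\<^esub> f (n - j)) =
      (\<Oplus>\<^bsub>M\<^esub>j \<in> {..k}. p j \<odot>\<^bsub>M\<^esub> (\<Oplus>\<^bsub>M\<^esub>i \<in> {..k - j}. q i \<odot>\<^bsub>M\<^esub> f (n - j - i)))" for k
  proof (induct k)
    case 0
    then show ?case using p q f by (simp add: Pi_def smult_assoc1)
  next
    case (Suc k)
    let ?s = "\<lambda>j. \<Oplus>\<^bsub>M\<^esub>i \<in> {..k - j}. q i \<odot>\<^bsub>M\<^esub> f (n - j - i)"
    have sc: "?s j \<in> carrier M" for j using q f by (auto intro!: M.finsum_closed)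
    have pq: "(\<Oplus>i \<in> {..Suc k}. p i \<otimes> q (Suc k - i)) \<in> carrier R"
      using p q by (auto intro!: R.finsum_closed)
    have L: "(\<Oplus>i \<in> {..Suc k}. p i \<otimes> q (Suc k - i)) \<odot>\<^bsub>M\<^esub> f (n - Suc k) =
        (\<Oplus>\<^bsub>M\<^esub>i \<in> {..Suc k}. p i \<odot>\<^bsub>M\<^esub> (q (Suc k - i) \<odot>\<^bsub>M\<^esub> f (n - Suc k)))"
      using p q f by (subst finsum_smult_rdistr) (auto simp: smult_assoc1 simp del: finsum_Suc)
    have step: "p j \<odot>\<^bsub>M\<^esub> (\<Oplus>\<^bsub>M\<^esub>i \<in> {..Suc k - j}. q i \<odot>\<^bsub>M\<^esub> f (n - j - i)) =
        p j \<odot>\<^bsub>M\<^esub> (q (Suc k - j) \<odot>\<^bsub>M\<^esub> f (n - Suc k)) \<oplus>\<^bsub>M\<^esub> p j \<odot>\<^bsub>M\<^esub> ?s j" if "j \<le> k" for j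
      using that p q f sc Suc.prems by (simp add: Suc_diff_le smult_r_distr Pi_def)
    have "(\<Oplus>\<^bsub>M\<^esub>j \<in> {..Suc k}. p j \<odot>\<^bsub>M\<^esub> (\<Oplus>\<^bsub>M\<^esub>i \<in> {..Suc k - j}. q i \<odot>\<^bsub>M\<^esub> f (n - j - i))) =
        p (Suc k) \<odot>\<^bsub>M\<^esub> (q 0 \<odot>\<^bsub>M\<^esub> f (n - Suc k)) \<oplus>\<^bsub>M\<^esub>
        (\<Oplus>\<^bsub>M\<^esub>j \<in> {..k}. p j \<odot>\<^bsub>M\<^esub> (\<Oplus>\<^bsub>M\<^esub>i \<in> {..Suc k - j}. q i \<odot>\<^bsub>M\<^esub> f (n - j - i)))"
      using p q f by (subst M.finsum_Suc) (auto intro!: M.finsum_closed)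
    also have "(\<Oplus>\<^bsub>M\<^esub>j \<in> {..k}. p j \<odot>\<^bsub>M\<^esub> (\<Oplus>\<^bsub>M\<^esub>i \<in> {..Suc k - j}. q i \<odot>\<^bsub>M\<^esub> f (n - j - i))) =
        (\<Oplus>\<^bsub>M\<^esub>j \<in> {..k}. p j \<odot>\<^bsub>M\<^esub> (q (Suc k - j) \<odot>\<^bsub>M\<^esub> f (n - Suc k)) \<oplus>\<^bsub>M\<^esub> p j \<odot>\<^bsub>M\<^esub> ?s j)"
      using p q f sc by (intro M.finsum_cong' refl step) (auto simp del: diff_diff_left)
    also have "\<dots> = (\<Oplus>\<^bsub>M\<^esub>j \<in> {..k}. p j \<odot>\<^bsub>M\<^esub> (q (Suc k - j) \<odot>\<^bsub>M\<^esub> f (n - Suc k))) \<oplus>\<^bsub>M\<^esub>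
        (\<Oplus>\<^bsub>M\<^esub>j \<in> {..k}. p j \<odot>\<^bsub>M\<^esub> ?s j)"
      using p q f sc by (intro M.finsum_addf) auto
    also have "p (Suc k) \<odot>\<^bsub>M\<^esub> (q 0 \<odot>\<^bsub>M\<^esub> f (n - Suc k)) \<oplus>\<^bsub>M\<^esub> \<dots> =
        (\<Oplus>\<^bsub>M\<^esub>j \<in> {..Suc k}. p j \<odot>\<^bsub>M\<^esub> (q (Suc k - j) \<odot>\<^bsub>M\<^esub> f (n - Suc k))) \<oplus>\<^bsub>M\<^esub>
        (\<Oplus>\<^bsub>M\<^esub>j \<in> {..k}. p j \<odot>\<^bsub>M\<^esub> ?s j)"
      using p q f sc by (subst M.finsum_Suc) (auto intro!: M.finsum_closed M.a_assoc[symmetric])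
    also have "\<dots> = (\<Oplus>\<^bsub>M\<^esub>j \<in> {..Suc k}. (\<Oplus>i \<in> {..j}. p i \<otimes> q (j - i)) \<odot>\<^bsub>M\<^esub> f (n - j))"
      unfolding L[symmetric] Suc.hyps[OF Suc_leD[OF Suc.prems], symmetric]
      using p q f pq
      by (subst M.finsum_Suc) (auto intro!: R.finsum_closed simp del: finsum_Suc)
    finally show ?case by (rule sym)
  qed
  from this[of n] show ?thesis by simp
qed

lemma rees_algebra_carrier:
  "carrier (rees_algebra R I) = {p \<in> up R. \<forall>n. p n \<in> ideal_pow R I n}"
  by (auto simp: rees_algebra_def UP_def)

lemma rees_algebra_cring:
  assumes I: "ideal I R" shows "cring (rees_algebra R I)"
proof -
  interpret P: UP_cring R "UP R" by unfold_locales simp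
  let ?H = "carrier (rees_algebra R I)"
  note ip = ideal_pow_ideal[OF I]
  have c: "coeff (UP R) p n = p n" if "p \<in> up R" for p n
    using that by (simp add: UP_def)
  have H: "p \<in> ?H \<longleftrightarrow> p \<in> carrier (UP R) \<and> (\<forall>n. coeff (UP R) p n \<in> ideal_pow R I n)" for p
    by (auto simp: rees_algebra_def)
  have "subcring ?H (UP R)"
  proof (intro P.P.subcringI' P.P.subringI)
    show "?H \<subseteq> carrier (UP R)" using H by blast
    show "\<one>\<^bsub>UP R\<^esub> \<in> ?H"
      using additive_subgroup.zero_closed[OF ideal.axioms(1)[OF ip]] ideal_pow_0[of I]
      by (auto simp: H simp del: nat_pow_0)
  next
    fix p assume "p \<in> ?H"
    then show "\<ominus>\<^bsub>UP R\<^esub> p \<in> ?H"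
      using additive_subgroup.a_inv_closed[OF ideal.axioms(1)[OF ip]] by (auto simp: H)
  next
    fix p q assume pq: "p \<in> ?H" "q \<in> ?H"
    then show "p \<oplus>\<^bsub>UP R\<^esub> q \<in> ?H"
      using additive_subgroup.a_closed[OF ideal.axioms(1)[OF ip]] by (auto simp: H)
    have "(\<Oplus>i \<in> {..n}. coeff (UP R) p i \<otimes> coeff (UP R) q (n - i)) \<in> ideal_pow R I n" for n
    proof (rule ideal_finsum[OF ip])
      fix i assume "i \<in> {..n}"
      then show "coeff (UP R) p i \<otimes> coeff (UP R) q (n - i) \<in> ideal_pow R I n"
        using ideal_pow_mult[OF I, of "coeff (UP R) p i" i "coeff (UP R) q (n - i)" "n - i"] pq
        by (auto simp: H)
    qed simp
    with pq show "p \<otimes>\<^bsub>UP R\<^esub> q \<in> ?H" by (auto simp: H)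
  qed
  then have "cring ((UP R)\<lparr>carrier := ?H\<rparr>)"
    using P.P.subcring_iff subcring.axioms(1) subring.axioms(1) H by blast
  then show ?thesis by (simp add: rees_algebra_def)
qed

theorem ratliff_rush_module_is_module:
  assumes I: "ideal I R"
  shows "module (rees_algebra R I) (ratliff_rush_module R M I)"
proof -
  let ?S = "rees_algebra R I" and ?N = "ratliff_rush_module R M I"
  note rr = ratliff_rush_submodule[OF I]
  have Nc: "f n \<in> carrier M" if "f \<in> carrier ?N" for f n
    using that ratliff_rush_carr[OF I] by (auto simp: ratliff_rush_module_def)
  have Sc: "p n \<in> carrier R" if "p \<in> carrier ?S" for p n
    using that by (auto simp: rees_algebra_carrier)
  have cf: "coeff (UP R) p n = p n" if "p \<in> carrier ?S" for p n
    using that by (simp add: rees_algebra_carrier UP_def)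
  have add: "f \<oplus>\<^bsub>?N\<^esub> g = (\<lambda>n. f n \<oplus>\<^bsub>M\<^esub> g n)" for f g
    by (simp add: ratliff_rush_module_def)
  have zero: "\<zero>\<^bsub>?N\<^esub> = (\<lambda>n. \<zero>\<^bsub>M\<^esub>)"
    by (simp add: ratliff_rush_module_def)
  have smult: "p \<odot>\<^bsub>?N\<^esub> f = (\<lambda>n. \<Oplus>\<^bsub>M\<^esub>i \<in> {..n}. p i \<odot>\<^bsub>M\<^esub> f (n - i))" if "p \<in> carrier ?S" for p f
    using that by (simp add: ratliff_rush_module_def cf)
  have mem: "f \<in> carrier ?N \<longleftrightarrow>
      (\<forall>n. f n \<in> ratliff_rush R M I n) \<and> finite {n. f n \<noteq> \<zero>\<^bsub>M\<^esub>}" for f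
    by (simp add: ratliff_rush_module_def)
  have ab: "abelian_group ?N"
  proof (rule abelian_groupI)
    fix f g assume fg: "f \<in> carrier ?N" "g \<in> carrier ?N"
    have "finite {n. f n \<oplus>\<^bsub>M\<^esub> g n \<noteq> \<zero>\<^bsub>M\<^esub>}"
      by (rule finite_subset[of _ "{n. f n \<noteq> \<zero>\<^bsub>M\<^esub>} \<union> {n. g n \<noteq> \<zero>\<^bsub>M\<^esub>}"]) (use fg mem in auto)
    then show "f \<oplus>\<^bsub>?N\<^esub> g \<in> carrier ?N"
      using fg by (simp add: mem add submoduleE(5)[OF rr])
    show "f \<oplus>\<^bsub>?N\<^esub> g = g \<oplus>\<^bsub>?N\<^esub> f" using fg Nc by (auto simp: add M.a_comm)
  next
    show "\<zero>\<^bsub>?N\<^esub> \<in> carrier ?N" using submodule_zero[OF rr] by (simp add: mem zero)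
  next
    fix f assume f: "f \<in> carrier ?N"
    show "\<zero>\<^bsub>?N\<^esub> \<oplus>\<^bsub>?N\<^esub> f = f" using f Nc by (auto simp: add zero)
    have "finite {n. \<ominus>\<^bsub>M\<^esub> f n \<noteq> \<zero>\<^bsub>M\<^esub>}"
      by (rule finite_subset[of _ "{n. f n \<noteq> \<zero>\<^bsub>M\<^esub>}"]) (use f mem in auto)
    then have "(\<lambda>n. \<ominus>\<^bsub>M\<^esub> f n) \<in> carrier ?N"
      using f submoduleE(3)[OF rr] by (simp add: mem)
    moreover have "(\<lambda>n. \<ominus>\<^bsub>M\<^esub> f n) \<oplus>\<^bsub>?N\<^esub> f = \<zero>\<^bsub>?N\<^esub>"
      using f Nc by (auto simp: add zero M.l_neg)
    ultimately show "\<exists>g \<in> carrier ?N. g \<oplus>\<^bsub>?N\<^esub> f = \<zero>\<^bsub>?N\<^esub>" by blast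
  next
    fix f g h assume "f \<in> carrier ?N" "g \<in> carrier ?N" "h \<in> carrier ?N"
    then show "f \<oplus>\<^bsub>?N\<^esub> g \<oplus>\<^bsub>?N\<^esub> h = f \<oplus>\<^bsub>?N\<^esub> (g \<oplus>\<^bsub>?N\<^esub> h)"
      using Nc by (auto simp: add M.a_assoc)
  qed
  interpret S: cring ?S by (rule rees_algebra_cring[OF I])
  show ?thesis
  proof (rule moduleI[OF S.is_cring ab])
    fix p f assume p: "p \<in> carrier ?S" and f: "f \<in> carrier ?N"
    have "(\<Oplus>\<^bsub>M\<^esub>i \<in> {..n}. p i \<odot>\<^bsub>M\<^esub> f (n - i)) \<in> ratliff_rush R M I n" for n
    proof (rule submodule_finsum[OF rr])
      fix i assume "i \<in> {..n}"
      then show "p i \<odot>\<^bsub>M\<^esub> f (n - i) \<in> ratliff_rush R M I n"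
        using ideal_pow_smult_ratliff_rush[OF I, of "p i" i "f (n - i)" "n - i"] p f
        by (auto simp: rees_algebra_carrier mem)
    qed simp
    moreover have "finite {n. (\<Oplus>\<^bsub>M\<^esub>i \<in> {..n}. p i \<odot>\<^bsub>M\<^esub> f (n - i)) \<noteq> \<zero>\<^bsub>M\<^esub>}"
    proof -
      from p obtain a where a: "\<And>n. a < n \<Longrightarrow> p n = \<zero>"
        by (auto simp: rees_algebra_carrier up_def bound_def)
      from f obtain b where b: "\<And>n. b < n \<Longrightarrow> f n = \<zero>\<^bsub>M\<^esub>"
        unfolding mem finite_nat_set_iff_bounded_le by (metis mem_Collect_eq not_le)
      have "(\<Oplus>\<^bsub>M\<^esub>i \<in> {..n}. p i \<odot>\<^bsub>M\<^esub> f (n - i)) = \<zero>\<^bsub>M\<^esub>" if n: "n > a + b" for n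
      proof -
        have "p i \<odot>\<^bsub>M\<^esub> f (n - i) = \<zero>\<^bsub>M\<^esub>" for i
          by (cases "a < i") (use n a b[of "n - i"] Sc[OF p] Nc[OF f] in auto)
        then show ?thesis by simp
      qed
      then have "{n. (\<Oplus>\<^bsub>M\<^esub>i \<in> {..n}. p i \<odot>\<^bsub>M\<^esub> f (n - i)) \<noteq> \<zero>\<^bsub>M\<^esub>} \<subseteq> {..a + b}"
        using not_le by blast
      then show ?thesis by (rule finite_subset) simp
    qed
    ultimately show "p \<odot>\<^bsub>?N\<^esub> f \<in> carrier ?N" by (simp add: mem smult[OF p])
  next
    fix p q f assume p: "p \<in> carrier ?S" and q: "q \<in> carrier ?S" and f: "f \<in> carrier ?N"
    have up: "p \<in> up R" "q \<in> up R" using p q by (auto simp: rees_algebra_carrier)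
    have "p \<oplus>\<^bsub>?S\<^esub> q = (\<lambda>n. p n \<oplus> q n)"
      using up by (simp add: rees_algebra_def UP_def)
    with p q f show "(p \<oplus>\<^bsub>?S\<^esub> q) \<odot>\<^bsub>?N\<^esub> f = p \<odot>\<^bsub>?N\<^esub> f \<oplus>\<^bsub>?N\<^esub> q \<odot>\<^bsub>?N\<^esub> f"
      using S.a_closed[OF p q] Sc[OF p] Sc[OF q] Nc[OF f]
      by (auto simp: smult add smult_l_distr Pi_def intro!: ext M.finsum_addf)
    have "p \<otimes>\<^bsub>?S\<^esub> q = (\<lambda>n. \<Oplus>i \<in> {..n}. p i \<otimes> q (n - i))"
      using up by (simp add: rees_algebra_def UP_def)
    with p q f show "(p \<otimes>\<^bsub>?S\<^esub> q) \<odot>\<^bsub>?N\<^esub> f = p \<odot>\<^bsub>?N\<^esub> (q \<odot>\<^bsub>?N\<^esub> f)"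
      using S.m_closed[OF p q] graded_smult_assoc[of p q f] Sc[OF p] Sc[OF q] Nc[OF f]
      by (auto simp: smult)
  next
    fix p f g assume p: "p \<in> carrier ?S" and f: "f \<in> carrier ?N" and g: "g \<in> carrier ?N"
    then show "p \<odot>\<^bsub>?N\<^esub> (f \<oplus>\<^bsub>?N\<^esub> g) = p \<odot>\<^bsub>?N\<^esub> f \<oplus>\<^bsub>?N\<^esub> p \<odot>\<^bsub>?N\<^esub> g"
      using Sc[OF p] Nc[OF f] Nc[OF g]
      by (auto simp: smult add smult_r_distr Pi_def intro!: ext M.finsum_addf)
  next
    fix f assume f: "f \<in> carrier ?N"
    have one: "\<one>\<^bsub>?S\<^esub> = (\<lambda>i. if i = 0 then \<one> else \<zero>)"
      by (simp add: rees_algebra_def UP_def)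
    have "(\<Oplus>\<^bsub>M\<^esub>i \<in> {..n}. \<one>\<^bsub>?S\<^esub> i \<odot>\<^bsub>M\<^esub> f (n - i)) = f n" for n
    proof -
      have "(\<Oplus>\<^bsub>M\<^esub>i \<in> {..n}. \<one>\<^bsub>?S\<^esub> i \<odot>\<^bsub>M\<^esub> f (n - i)) =
          (\<Oplus>\<^bsub>M\<^esub>i \<in> {..n}. if 0 = i then f (n - i) else \<zero>\<^bsub>M\<^esub>)"
        using Nc[OF f] by (intro M.finsum_cong') (auto simp: one)
      also have "\<dots> = f (n - 0)"
        using Nc[OF f] by (intro M.finsum_singleton) auto
      finally show ?thesis by simp
    qed
    then show "\<one>\<^bsub>?S\<^esub> \<odot>\<^bsub>?N\<^esub> f = f" by (auto simp: smult)
  qed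
qed

end

end

theory Submission
  imports Defs
begin

text \<open>
  An element \<open>m\<close> killed by \<open>I\<^sup>k\<close> lies in \<open>(I\<^sup>n\<^sup>+\<^sup>k M : I\<^sup>k)\<close> for every \<open>n\<close>, so \<open>torsion_H0 R M I\<close> is contained
  in every term of the Ratliff-Rush filtration.  It therefore suffices that this filtration is,
  up to a fixed shift \<open>d\<close>, no larger than the \<open>I\<close>-adic one
  (\<open>ratliff_rush_subset_shifted_ideal_smult\<close>): then \<open>m\<close> lies in every \<open>I\<^sup>n M\<close> and vanishes by
  separatedness.

  The shift comes from finite generation of the Ratliff-Rush module.  Finitely many generators
  have components only in degrees at most some \<open>d\<close>, and an element of degree \<open>n\<close> is a sum of
  products of elements of \<open>I\<^sup>n\<^sup>-\<^sup>j\<close> with components of degree \<open>j \<le> d\<close>, hence lies in \<open>I\<^sup>n\<^sup>-\<^sup>d M\<close>.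
  Rather than writing out such sums, the proof checks that the sequences whose \<open>n\<close>-th entry
  lies in \<open>I\<^sup>n\<^sup>-\<^sup>d M\<close> form a submodule containing the generators
  (\<open>shifted_adic_sequences_submodule\<close>).
\<close>

context module
begin

lemma ideal_smult_pow_antimono:
  assumes I: "ideal I R" and "m \<le> n"
  shows "ideal_smult R M (ideal_pow R I n) (carrier M)
    \<subseteq> ideal_smult R M (ideal_pow R I m) (carrier M)"
proof -
  from \<open>m \<le> n\<close> obtain c where n: "n = m + c" using le_Suc_ex by blast
  have "ideal_pow R I n \<subseteq> ideal_pow R I m"
    unfolding n ideal_pow_add[OF I]
    using R.ideal_prod_inter[OF ideal_pow_ideal[OF I] ideal_pow_ideal[OF I]] by blast
  then have "{a \<odot>\<^bsub>M\<^esub> x | a x. a \<in> ideal_pow R I n \<and> x \<in> carrier M}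
      \<subseteq> ideal_smult R M (ideal_pow R I m) (carrier M)"
    by (auto intro: ideal_smult_mem)
  then show ?thesis
    unfolding ideal_smult_def[of R M "ideal_pow R I n"]
    by (rule submodule_span_least[OF ideal_smult_submodule[OF I]])
qed

lemma ideal_smult_pow_0:
  "ideal_smult R M (ideal_pow R I 0) (carrier M) = carrier M"
proof
  show "ideal_smult R M (ideal_pow R I 0) (carrier M) \<subseteq> carrier M"
    unfolding ideal_smult_def ideal_pow_0
    by (rule submodule_span_least[OF carrier_is_submodule]) auto
  show "carrier M \<subseteq> ideal_smult R M (ideal_pow R I 0) (carrier M)"
  proof
    fix x assume x: "x \<in> carrier M"
    have "\<one> \<odot>\<^bsub>M\<^esub> x \<in> ideal_smult R M (ideal_pow R I 0) (carrier M)"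
      by (rule ideal_smult_mem) (use x ideal_pow_0 in auto)
    with x show "x \<in> ideal_smult R M (ideal_pow R I 0) (carrier M)" by simp
  qed
qed

text \<open>
  The subtraction is truncated, so the condition is empty in degrees up to \<open>d\<close>.  Closure under
  homogeneous scalars of degree \<open>i\<close> amounts to \<open>n - d \<le> i + (n - i - d)\<close>.
\<close>

lemma shifted_adic_sequences_submodule:
  assumes I: "ideal I R"
  shows "submodule
    {f \<in> carrier (ratliff_rush_module R M I).
      \<forall>n. f n \<in> ideal_smult R M (ideal_pow R I (n - d)) (carrier M)}
    (rees_algebra R I) (ratliff_rush_module R M I)"
proof -
  let ?S = "rees_algebra R I" and ?N = "ratliff_rush_module R M I"
  interpret N: module ?S ?N by (rule ratliff_rush_module_is_module[OF I])
  let ?F = "\<lambda>n. ideal_smult R M (ideal_pow R I n) (carrier M)"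
  note F = ideal_smult_submodule[OF I]
  have entry: "f n \<in> carrier M" if "f \<in> carrier ?N" for f n
    using that ratliff_rush_carr[OF I] by (auto simp: ratliff_rush_module_def)
  \<comment> \<open>The negative in the sequence module is given by an inverse property, not entrywise, so it
    has to be identified.\<close>
  have minus: "(\<ominus>\<^bsub>?N\<^esub> f) n = \<ominus>\<^bsub>M\<^esub> f n" if f: "f \<in> carrier ?N" for f n
  proof -
    have "(\<ominus>\<^bsub>?N\<^esub> f \<oplus>\<^bsub>?N\<^esub> f) n = \<zero>\<^bsub>?N\<^esub> n" using N.M.l_neg[OF f] by simp
    then have "(\<ominus>\<^bsub>?N\<^esub> f) n \<oplus>\<^bsub>M\<^esub> f n = \<zero>\<^bsub>M\<^esub>" by (simp add: ratliff_rush_module_def)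
    then show ?thesis using M.minus_equality entry[OF f] entry[OF N.M.a_inv_closed[OF f]] by metis
  qed
  show ?thesis
  proof (rule N.submoduleI)
    show "\<zero>\<^bsub>?N\<^esub> \<in> {f \<in> carrier ?N. \<forall>n. f n \<in> ?F (n - d)}"
      using N.M.zero_closed submodule_zero[OF F] by (simp add: ratliff_rush_module_def)
  next
    fix f assume "f \<in> {f \<in> carrier ?N. \<forall>n. f n \<in> ?F (n - d)}"
    then show "\<ominus>\<^bsub>?N\<^esub> f \<in> {f \<in> carrier ?N. \<forall>n. f n \<in> ?F (n - d)}"
      using submoduleE(3)[OF F] by (simp add: minus)
  next
    fix f g assume "f \<in> {f \<in> carrier ?N. \<forall>n. f n \<in> ?F (n - d)}"
      and "g \<in> {f \<in> carrier ?N. \<forall>n. f n \<in> ?F (n - d)}"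
    moreover have "(f \<oplus>\<^bsub>?N\<^esub> g) n = f n \<oplus>\<^bsub>M\<^esub> g n" for n
      by (simp add: ratliff_rush_module_def)
    ultimately show "f \<oplus>\<^bsub>?N\<^esub> g \<in> {f \<in> carrier ?N. \<forall>n. f n \<in> ?F (n - d)}"
      using submoduleE(5)[OF F] by simp
  next
    fix p f assume p: "p \<in> carrier ?S" and f: "f \<in> {f \<in> carrier ?N. \<forall>n. f n \<in> ?F (n - d)}"
    have "(p \<odot>\<^bsub>?N\<^esub> f) n \<in> ?F (n - d)" for n
    proof -
      have "(\<Oplus>\<^bsub>M\<^esub>i \<in> {..n}. coeff (UP R) p i \<odot>\<^bsub>M\<^esub> f (n - i)) \<in> ?F (n - d)"
      proof (rule submodule_finsum[OF F])
        fix i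
        have "coeff (UP R) p i \<in> ideal_pow R I i" using p by (simp add: rees_algebra_def)
        moreover have "f (n - i) \<in> ?F (n - i - d)" using f by blast
        ultimately have "coeff (UP R) p i \<odot>\<^bsub>M\<^esub> f (n - i) \<in> ?F (i + (n - i - d))"
          by (rule ideal_pow_smult[OF I])
        moreover have "n - d \<le> i + (n - i - d)" by simp
        ultimately show "coeff (UP R) p i \<odot>\<^bsub>M\<^esub> f (n - i) \<in> ?F (n - d)"
          using ideal_smult_pow_antimono[OF I] by blast
      qed simp
      then show ?thesis by (simp add: ratliff_rush_module_def)
    qed
    with p f show "p \<odot>\<^bsub>?N\<^esub> f \<in> {f \<in> carrier ?N. \<forall>n. f n \<in> ?F (n - d)}" by simp
  qed auto
qed

lemma ratliff_rush_subset_shifted_ideal_smult: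
  assumes I: "ideal I R"
    and fg: "finitely_generated_module (rees_algebra R I) (ratliff_rush_module R M I)"
  obtains d where
    "\<And>n. ratliff_rush R M I n \<subseteq> ideal_smult R M (ideal_pow R I (n - d)) (carrier M)"
proof -
  let ?S = "rees_algebra R I" and ?N = "ratliff_rush_module R M I"
  let ?F = "\<lambda>n. ideal_smult R M (ideal_pow R I n) (carrier M)"
  interpret N: finitely_generated_module ?S ?N by (rule fg)
  obtain A where A: "A \<subseteq> carrier ?N" "finite A" and gen: "carrier ?N = submodule_span ?S ?N A"
    using N.finitely_generated by blast
  have "finite (\<Union>f\<in>A. {n. f n \<noteq> \<zero>\<^bsub>M\<^esub>})"
    using A by (auto simp: ratliff_rush_module_def)
  then obtain d where "(\<Union>f\<in>A. {n. f n \<noteq> \<zero>\<^bsub>M\<^esub>}) \<subseteq> {..d}"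
    unfolding finite_nat_set_iff_bounded_le by blast
  then have d: "f n = \<zero>\<^bsub>M\<^esub>" if "f \<in> A" "d < n" for f n
    using that by fastforce
  have "f n \<in> ?F (n - d)" if f: "f \<in> A" for f n
  proof (cases "d < n")
    case True
    then show ?thesis using d[OF f] submodule_zero[OF ideal_smult_submodule[OF I]] by simp
  next
    case False
    then have "n - d = 0" by simp
    moreover have "f n \<in> carrier M"
      using f A(1) ratliff_rush_carr[OF I] by (auto simp: ratliff_rush_module_def)
    ultimately show ?thesis using ideal_smult_pow_0 by metis
  qed
  then have "carrier ?N \<subseteq> {f \<in> carrier ?N. \<forall>n. f n \<in> ?F (n - d)}"
    unfolding gen using A(1) gen
    by (intro N.submodule_span_least shifted_adic_sequences_submodule[OF I, of d, unfolded gen])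
      auto
  then have *: "f n \<in> ?F (n - d)" if "f \<in> carrier ?N" for f n
    using that by blast
  have "x \<in> ?F (n - d)" if x: "x \<in> ratliff_rush R M I n" for x n
  proof -
    \<comment> \<open>Regard \<open>x\<close> as a homogeneous element of degree \<open>n\<close>.\<close>
    have "(\<lambda>i. if i = n then x else \<zero>\<^bsub>M\<^esub>) \<in> carrier ?N"
      using x submodule_zero[OF ratliff_rush_submodule[OF I]]
      by (auto simp: ratliff_rush_module_def)
    from *[OF this, of n] show ?thesis by simp
  qed
  then show thesis using that by blast
qed

lemma torsion_H0_subset_ratliff_rush:
  assumes I: "ideal I R"
  shows "torsion_H0 R M I \<subseteq> ratliff_rush R M I n"
proof
  fix m assume "m \<in> torsion_H0 R M I"
  then obtain k where m: "m \<in> carrier M" "1 \<le> k"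
    and z: "\<And>a. a \<in> ideal_pow R I k \<Longrightarrow> a \<odot>\<^bsub>M\<^esub> m = \<zero>\<^bsub>M\<^esub>"
    by (auto simp: torsion_H0_def)
  have "m \<in> rr_colon I n k"
    using m z submodule_zero[OF ideal_smult_submodule[OF I]]
    by (simp add: rr_colon_def module_colon_def)
  with m show "m \<in> ratliff_rush R M I n" by (auto simp: ratliff_rush_alt)
qed

lemma zero_in_torsion_H0:
  assumes I: "ideal I R"
  shows "\<zero>\<^bsub>M\<^esub> \<in> torsion_H0 R M I"
  using ideal_pow_carr[OF I] by (auto simp: torsion_H0_def)

end

lemma (in noetherian_module) finitely_generated_module: "finitely_generated_module R M"
  using submodules_finitely_generated[OF carrier_is_submodule] by unfold_locales

theorem corollary7p6:
  fixes R :: "('a, 'c) ring_scheme" and M :: "('a, 'b, 'd) module_scheme" and I :: "'a set"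
  assumes "cring R"
    and "noetherian_ring R"
    and "ideal I R"
    and "finitely_generated_module R M"
    and "noetherian_module (rees_algebra R I) (ratliff_rush_module R M I)"
    and "adically_separated R M I"
  shows "torsion_H0 R M I = {\<zero>\<^bsub>M\<^esub>}"
proof -
  interpret module R M using assms(4) by (rule finitely_generated_module.axioms)
  obtain d where d:
    "\<And>n. ratliff_rush R M I n \<subseteq> ideal_smult R M (ideal_pow R I (n - d)) (carrier M)"
    using ratliff_rush_subset_shifted_ideal_smult[OF assms(3)
        noetherian_module.finitely_generated_module[OF assms(5)]] by blast
  have "torsion_H0 R M I \<subseteq> ideal_smult R M (ideal_pow R I n) (carrier M)" for n
    using torsion_H0_subset_ratliff_rush[OF assms(3), of "n + d"] d[of "n + d"] by simp
  then have "torsion_H0 R M I \<subseteq> {\<zero>\<^bsub>M\<^esub>}"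
    using assms(6) unfolding adically_separated_def by blast
  then show ?thesis using zero_in_torsion_H0[OF assms(3)] by blast
qed

end
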